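(* Let $n\ge 1$ be an integer, and let $p\ge 2$ and $q>0$ be real numbers. Let $u$ be a positive bounded classical solution of $$-\Delta u = u^q|\nabla u|^p \quad\text{in } \mathbb{R}^n.$$ Then $u$ is constant.
   Context: A positive bounded classical solution means a bounded function $u\in C^2(\mathbb{R}^n)$ with $u(x)>0$ for all $x\in\mathbb{R}^n$ that satisfies the equation pointwise on $\mathbb{R}^n$. Here $|\cdot|$ is the Euclidean norm, $\nabla u$ the gradient and $\Delta u$ the Laplacian. *)

theory Defs
  imports "HOL-Analysis.Analysis"
begin

definition partial_deriv :: "'n \<Rightarrow> (real ^ 'n::finite \<Rightarrow> real) \<Rightarrow> real ^ 'n \<Rightarrow> real"
  where "partial_deriv i f x = deriv (\<lambda>t. f (x + t *\<^sub>R axis i 1)) 0"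

text \<open>
  The value of \<^const>\<open>deriv\<close> is unspecified where the derivative does not exist,
  so existence of the partial derivatives is a separate predicate.
\<close>

definition has_partial_derivs :: "(real ^ 'n::finite \<Rightarrow> real) \<Rightarrow> bool"
  where "has_partial_derivs f \<longleftrightarrow>
    (\<forall>i x. (\<lambda>t. f (x + t *\<^sub>R axis i 1)) field_differentiable at 0)"

definition C2 :: "(real ^ 'n::finite \<Rightarrow> real) \<Rightarrow> bool"
  where "C2 f \<longleftrightarrow>
    continuous_on UNIV f \<and>
    has_partial_derivs f \<and>
    (\<forall>i. continuous_on UNIV (partial_deriv i f)) \<and>
    (\<forall>i. has_partial_derivs (partial_deriv i f)) \<and>
    (\<forall>i j. continuous_on UNIV (partial_deriv j (partial_deriv i f)))"

definition grad :: "(real ^ 'n::finite \<Rightarrow> real) \<Rightarrow> real ^ 'n \<Rightarrow> real ^ 'n"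
  where "grad f x = (\<chi> i. partial_deriv i f x)"

definition laplacian :: "(real ^ 'n::finite \<Rightarrow> real) \<Rightarrow> real ^ 'n \<Rightarrow> real"
  where "laplacian f x = (\<Sum>i\<in>UNIV. partial_deriv i (partial_deriv i f) x)"

end

theory Submission
  imports Defs
begin

text \<open>
  Choose \<open>g > 0\<close> and put \<open>v = \<psi> u\<close> with \<open>\<psi>' = 1 / g\<close>. Then \<open>\<Delta>v = - C(|\<nabla>v|, u)\<close> with
  \<open>C(r, a) = g'(a) r\<^sup>2 + a powr q * g(a) powr (p - 1) * r powr p\<close>, and \<open>g\<close> can be chosen such that
  \<open>C(s, _)\<close> is strictly decreasing for all small \<open>s > 0\<close>. At a maximum of \<open>v y - v x - s |y - x|\<close>
  with positive value both gradients have length \<open>s\<close>, and translating both points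
  simultaneously gives \<open>\<Delta>v(y) \<le> \<Delta>v(x)\<close>, hence \<open>C(s, u x) \<le> C(s, u y)\<close>; but \<open>u x < u y\<close>, a
  contradiction. Since the maximum need not be attained, the argument is applied with the
  penalty \<open>\<epsilon> |x|\<^sup>2\<close>, letting \<open>\<epsilon>\<close> tend to \<open>0\<close>. So \<open>v\<close> is \<open>s\<close>-Lipschitz for all small \<open>s\<close>.
  Comparing values at two points needs only second derivatives of \<open>u\<close>, whereas
  the usual Bernstein argument needs third derivatives.
\<close>

section \<open>Calculus along the coordinate axes\<close>

text \<open>If \<open>l\<close> were positive, \<open>f'\<close> would be positive just to the right
  of its zero at \<open>0\<close>, and \<open>f\<close> would rise above its maximum there.\<close>

lemma second_derivative_nonpos_at_max:
  fixes f f' :: "real \<Rightarrow> real"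
  assumes f: "\<And>t. (f has_real_derivative f' t) (at t)"
    and f': "(f' has_real_derivative l) (at 0)"
    and max: "\<And>t. f t \<le> f 0"
  shows "f' 0 = 0" "l \<le> 0"
proof -
  show f'0: "f' 0 = 0"
    by (rule DERIV_local_max[OF f, of 1]) (auto intro: max)
  show "l \<le> 0"
  proof (rule ccontr)
    assume "\<not> l \<le> 0"
    then obtain d where d: "d > 0" "\<And>h. h > 0 \<Longrightarrow> h < d \<Longrightarrow> f' 0 < f' (0 + h)"
      using DERIV_pos_inc_right[OF f'] by auto
    have "f 0 < f (d / 2)"
    proof (rule DERIV_pos_imp_increasing_open[of 0 "d / 2" f])
      show "\<exists>y. (f has_real_derivative y) (at t) \<and> y > 0" if "0 < t" "t < d / 2" for t
        using f[of t] d(2)[of t] d(1) that f'0 by auto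
      show "continuous_on {0..d / 2} f"
        by (meson DERIV_continuous_on f has_field_derivative_at_within)
    qed (use d in auto)
    with max[of "d / 2"] show False by simp
  qed
qed

text \<open>\<open>partial_deriv\<close> is a derivative at parameter \<open>0\<close>. Moving the
  base point carries it to every \<open>t\<close>, because the second derivative test needs
  derivatives along the whole line.\<close>

lemma has_real_derivative_along_axis:
  fixes f :: "real ^ 'n::finite \<Rightarrow> real"
  assumes "has_partial_derivs f"
  shows "((\<lambda>t. f (x + t *\<^sub>R axis i 1)) has_real_derivative
    partial_deriv i f (x + t *\<^sub>R axis i 1)) (at t)"
proof -
  let ?y = "x + t *\<^sub>R axis i 1"
  have "((\<lambda>h. f (?y + h *\<^sub>R axis i 1)) has_real_derivative partial_deriv i f ?y) (at 0)"
    using assms unfolding has_partial_derivs_def partial_deriv_def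
    by (simp add: DERIV_deriv_iff_field_differentiable)
  then have "((\<lambda>h. f (x + (t + h) *\<^sub>R axis i 1)) has_real_derivative partial_deriv i f ?y) (at 0)"
    by (simp add: scaleR_add_left add.assoc)
  then show ?thesis
    using DERIV_at_within_shift[of "\<lambda>t. f (x + t *\<^sub>R axis i 1)" "partial_deriv i f ?y" t 0 UNIV]
    by (simp add: add.commute)
qed

lemma has_partial_derivsI:
  fixes f :: "real ^ 'n::finite \<Rightarrow> real"
  assumes "\<And>i x. ((\<lambda>t. f (x + t *\<^sub>R axis i 1)) has_real_derivative D i x) (at 0)"
  shows "has_partial_derivs f" "partial_deriv i f = D i"
  using assms unfolding has_partial_derivs_def partial_deriv_def
  by (auto simp: field_differentiable_def intro!: ext DERIV_imp_deriv)

text \<open>The outer function is differentiated only at values of \<open>u\<close>, so that it may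
  later be an antiderivative known on an interval only.\<close>

lemma partial_derivs_compose:
  fixes u :: "real ^ 'n::finite \<Rightarrow> real"
  assumes u: "has_partial_derivs u" and \<psi>: "\<And>x. (\<psi> has_real_derivative \<psi>' (u x)) (at (u x))"
  shows "has_partial_derivs (\<lambda>x. \<psi> (u x))"
    and "partial_deriv i (\<lambda>x. \<psi> (u x)) = (\<lambda>x. \<psi>' (u x) * partial_deriv i u x)"
proof -
  have "((\<lambda>t. \<psi> (u (x + t *\<^sub>R axis i 1))) has_real_derivative \<psi>' (u x) * partial_deriv i u x) (at 0)"
    for i x
    using DERIV_chain2[OF _ has_real_derivative_along_axis[OF u, of x i 0], of \<psi> "\<psi>' (u x)"] \<psi>[of x]
    by simp
  from has_partial_derivsI[of "\<lambda>x. \<psi> (u x)" "\<lambda>i x. \<psi>' (u x) * partial_deriv i u x", OF this]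
  show "has_partial_derivs (\<lambda>x. \<psi> (u x))"
    "partial_deriv i (\<lambda>x. \<psi> (u x)) = (\<lambda>x. \<psi>' (u x) * partial_deriv i u x)" by blast+
qed

lemma partial_derivs_mult:
  fixes f h :: "real ^ 'n::finite \<Rightarrow> real"
  assumes f: "has_partial_derivs f" and h: "has_partial_derivs h"
  shows "has_partial_derivs (\<lambda>x. f x * h x)"
    and "partial_deriv i (\<lambda>x. f x * h x) = (\<lambda>x. partial_deriv i f x * h x + partial_deriv i h x * f x)"
proof -
  have "((\<lambda>t. f (x + t *\<^sub>R axis i 1) * h (x + t *\<^sub>R axis i 1)) has_real_derivative
      partial_deriv i f x * h x + partial_deriv i h x * f x) (at 0)" for i x
    using DERIV_mult[OF has_real_derivative_along_axis[OF f, of x i 0]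
        has_real_derivative_along_axis[OF h, of x i 0]]
    by simp
  from has_partial_derivsI[of "\<lambda>x. f x * h x"
      "\<lambda>i x. partial_deriv i f x * h x + partial_deriv i h x * f x", OF this]
  show "has_partial_derivs (\<lambda>x. f x * h x)"
    "partial_deriv i (\<lambda>x. f x * h x) = (\<lambda>x. partial_deriv i f x * h x + partial_deriv i h x * f x)"
    by blast+
qed

lemma grad_compose:
  fixes u :: "real ^ 'n::finite \<Rightarrow> real"
  assumes "has_partial_derivs u" and "\<And>x. (\<psi> has_real_derivative \<psi>' (u x)) (at (u x))"
  shows "grad (\<lambda>x. \<psi> (u x)) x = \<psi>' (u x) *\<^sub>R grad u x"
  by (simp add: grad_def partial_derivs_compose(2)[OF assms] vec_eq_iff)

lemma laplacian_compose:
  fixes u :: "real ^ 'n::finite \<Rightarrow> real"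
  assumes u: "has_partial_derivs u" and u2: "\<And>i. has_partial_derivs (partial_deriv i u)"
    and \<psi>: "\<And>x. (\<psi> has_real_derivative \<psi>' (u x)) (at (u x))"
    and \<psi>': "\<And>x. (\<psi>' has_real_derivative \<psi>'' (u x)) (at (u x))"
  shows "has_partial_derivs (partial_deriv i (\<lambda>x. \<psi> (u x)))"
    and "laplacian (\<lambda>x. \<psi> (u x)) x = \<psi>' (u x) * laplacian u x + \<psi>'' (u x) * (norm (grad u x))\<^sup>2"
proof -
  have 1: "partial_deriv i (\<lambda>x. \<psi> (u x)) = (\<lambda>x. \<psi>' (u x) * partial_deriv i u x)" for i
    by (rule partial_derivs_compose(2)[OF u \<psi>])
  note c = partial_derivs_compose[of u \<psi>' \<psi>'', OF u \<psi>']
  show "has_partial_derivs (partial_deriv i (\<lambda>x. \<psi> (u x)))"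
    unfolding 1 by (rule partial_derivs_mult(1)[OF c(1) u2])
  show "laplacian (\<lambda>x. \<psi> (u x)) x = \<psi>' (u x) * laplacian u x + \<psi>'' (u x) * (norm (grad u x))\<^sup>2"
    unfolding laplacian_def 1 partial_derivs_mult(2)[OF c(1) u2] c(2) power2_norm_eq_inner
      inner_vec_def grad_def
    by (simp add: sum.distrib sum_distrib_left algebra_simps)
qed

section \<open>Doubling of variables\<close>

text \<open>Stationarity in \<open>y\<close> alone and in \<open>x\<close> alone yields the two
  gradients. The Laplacians are compared by moving both points along one axis at a time and summing
  over the axes; the quadratic penalty contributes \<open>2 * \<epsilon>\<close> per axis.\<close>

lemma doubled_max_conditions:
  fixes v :: "real ^ 'n::finite \<Rightarrow> real"
  assumes v: "has_partial_derivs v" and v2: "\<And>i. has_partial_derivs (partial_deriv i v)"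
    and "x \<noteq> y"
    and max: "\<And>x' y'. v y' - v x' - s * norm (y' - x') - \<epsilon> * (norm x')\<^sup>2
                \<le> v y - v x - s * norm (y - x) - \<epsilon> * (norm x)\<^sup>2"
  shows "grad v y = (s / norm (y - x)) *\<^sub>R (y - x)"
    and "grad v x = (s / norm (y - x)) *\<^sub>R (y - x) - (2 * \<epsilon>) *\<^sub>R x"
    and "laplacian v y - laplacian v x \<le> 2 * \<epsilon> * real CARD('n)"
proof -
  let ?e = "\<lambda>i. axis i 1 :: real ^ 'n"
  have sq: "(norm (z + t *\<^sub>R ?e i))\<^sup>2 = (norm z)\<^sup>2 + 2 * t * z $ i + t\<^sup>2" for z :: "real ^ 'n" and t i
    unfolding power2_norm_eq_inner
    by (simp add: inner_add_left inner_add_right inner_axis inner_axis' power2_eq_square algebra_simps)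
  have dsq: "((\<lambda>t. (norm (z + t *\<^sub>R ?e i))\<^sup>2) has_real_derivative 2 * (z + t *\<^sub>R ?e i) $ i) (at t)"
    for z t i
    unfolding sq by (auto intro!: derivative_eq_intros simp: axis_def)
  have dnorm: "((\<lambda>t. norm (z + t *\<^sub>R ?e i)) has_real_derivative z $ i / norm z) (at 0)"
    if "z \<noteq> 0" for z i
  proof -
    \<comment> \<open>Away from \<open>z = 0\<close> the norm is differentiated as the square root
      of the quadratic polynomial in \<open>t\<close> found above.\<close>
    have "((\<lambda>t. sqrt ((norm (z + t *\<^sub>R ?e i))\<^sup>2)) has_real_derivative
        (2 * z $ i) * (inverse (sqrt ((norm z)\<^sup>2)) / 2)) (at 0)"
      using DERIV_chain2[OF _ dsq[of z i 0], of sqrt "inverse (sqrt ((norm z)\<^sup>2)) / 2"]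
        DERIV_real_sqrt[of "(norm z)\<^sup>2"] that by (simp add: mult.commute)
    moreover have "(2 * z $ i) * (inverse (sqrt ((norm z)\<^sup>2)) / 2) = z $ i / norm z"
      by (simp add: field_simps)
    ultimately show ?thesis by simp
  qed
  have dv: "((\<lambda>t. v (z + t *\<^sub>R ?e i)) has_real_derivative partial_deriv i v (z + t *\<^sub>R ?e i)) (at t)"
    for z i t by (rule has_real_derivative_along_axis[OF v])
  have dv0: "((\<lambda>t. v (z + t *\<^sub>R ?e i)) has_real_derivative partial_deriv i v z) (at 0)" for z i
    using dv[of z i 0] by simp
  have ne: "y - x \<noteq> 0" "x - y \<noteq> 0" using \<open>x \<noteq> y\<close> by auto
  have gy: "partial_deriv i v y = s * ((y - x) $ i / norm (y - x))" for i
  proof -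
    have d: "((\<lambda>t. v (y + t *\<^sub>R ?e i) - s * norm ((y - x) + t *\<^sub>R ?e i)) has_real_derivative
        partial_deriv i v y - s * ((y - x) $ i / norm (y - x))) (at 0)"
      by (intro DERIV_diff DERIV_cmult dv0 dnorm ne)
    have "partial_deriv i v y - s * ((y - x) $ i / norm (y - x)) = 0"
      by (rule DERIV_local_max[OF d, of 1])
        (use max[of "y + t *\<^sub>R ?e i" x for t] in \<open>auto simp: algebra_simps\<close>)
    then show ?thesis by simp
  qed
  have gx: "partial_deriv i v x = s * ((y - x) $ i / norm (y - x)) - 2 * \<epsilon> * x $ i" for i
  proof -
    have d: "((\<lambda>t. - v (x + t *\<^sub>R ?e i) - s * norm ((x - y) + t *\<^sub>R ?e i)
          - \<epsilon> * (norm (x + t *\<^sub>R ?e i))\<^sup>2) has_real_derivative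
        - partial_deriv i v x - s * ((x - y) $ i / norm (x - y)) - \<epsilon> * (2 * x $ i)) (at 0)"
      using dsq[of x i 0]
      by (intro DERIV_diff DERIV_minus DERIV_cmult dv0 dnorm ne) simp
    have "- partial_deriv i v x - s * ((x - y) $ i / norm (x - y)) - \<epsilon> * (2 * x $ i) = 0"
    proof (rule DERIV_local_max[OF d, of 1], simp, intro allI impI)
      fix t :: real
      have "norm (y - (x + t *\<^sub>R ?e i)) = norm ((x - y) + t *\<^sub>R ?e i)"
        by (metis add_diff_eq diff_add_eq norm_minus_commute)
      then show "- v (x + t *\<^sub>R ?e i) - s * norm ((x - y) + t *\<^sub>R ?e i) - \<epsilon> * (norm (x + t *\<^sub>R ?e i))\<^sup>2
        \<le> - v (x + 0 *\<^sub>R ?e i) - s * norm ((x - y) + 0 *\<^sub>R ?e i) - \<epsilon> * (norm (x + 0 *\<^sub>R ?e i))\<^sup>2"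
        using max[of y "x + t *\<^sub>R ?e i"] by (simp add: norm_minus_commute)
    qed
    then show ?thesis
      by (simp add: norm_minus_commute[of x y] diff_divide_distrib algebra_simps)
  qed
  show "grad v y = (s / norm (y - x)) *\<^sub>R (y - x)"
    by (simp add: vec_eq_iff grad_def gy)
  show "grad v x = (s / norm (y - x)) *\<^sub>R (y - x) - (2 * \<epsilon>) *\<^sub>R x"
    by (simp add: vec_eq_iff grad_def gx)
  \<comment> \<open>Translating both points together leaves the distance term unchanged.\<close>
  have "partial_deriv i (partial_deriv i v) y - partial_deriv i (partial_deriv i v) x - \<epsilon> * 2 \<le> 0" for i
  proof (rule second_derivative_nonpos_at_max(2))
    show "((\<lambda>t. v (y + t *\<^sub>R ?e i) - v (x + t *\<^sub>R ?e i) - \<epsilon> * (norm (x + t *\<^sub>R ?e i))\<^sup>2)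
      has_real_derivative partial_deriv i v (y + t *\<^sub>R ?e i) - partial_deriv i v (x + t *\<^sub>R ?e i)
        - \<epsilon> * (2 * (x + t *\<^sub>R ?e i) $ i)) (at t)" for t
      by (intro DERIV_diff DERIV_cmult dv dsq)
    have d2: "((\<lambda>t. partial_deriv i v (z + t *\<^sub>R ?e i)) has_real_derivative
        partial_deriv i (partial_deriv i v) z) (at 0)" for z
      using has_real_derivative_along_axis[OF v2, of i z i 0] by simp
    have "((\<lambda>t. 2 * (x + t *\<^sub>R ?e i) $ i) has_real_derivative 2) (at 0)"
      by (auto intro!: derivative_eq_intros simp: axis_def)
    then show "((\<lambda>t. partial_deriv i v (y + t *\<^sub>R ?e i) - partial_deriv i v (x + t *\<^sub>R ?e i)
        - \<epsilon> * (2 * (x + t *\<^sub>R ?e i) $ i)) has_real_derivative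
      partial_deriv i (partial_deriv i v) y - partial_deriv i (partial_deriv i v) x - \<epsilon> * 2) (at 0)"
      by (intro DERIV_diff DERIV_cmult d2)
    show "v (y + t *\<^sub>R ?e i) - v (x + t *\<^sub>R ?e i) - \<epsilon> * (norm (x + t *\<^sub>R ?e i))\<^sup>2
      \<le> v (y + 0 *\<^sub>R ?e i) - v (x + 0 *\<^sub>R ?e i) - \<epsilon> * (norm (x + 0 *\<^sub>R ?e i))\<^sup>2" for t
      using max[of "y + t *\<^sub>R ?e i" "x + t *\<^sub>R ?e i"] by simp
  qed
  then have "(\<Sum>i\<in>UNIV. partial_deriv i (partial_deriv i v) y - partial_deriv i (partial_deriv i v) x)
      \<le> (\<Sum>i\<in>(UNIV::'n set). 2 * \<epsilon>)"
    by (intro sum_mono) (simp add: algebra_simps)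
  then show "laplacian v y - laplacian v x \<le> 2 * \<epsilon> * real CARD('n)"
    by (simp add: laplacian_def sum_subtractf algebra_simps)
qed

text \<open>The penalties force compactness: the functional vanishes at the pair of origins and is
  negative outside a product of two balls, so its maximum over that product is global.\<close>

lemma doubled_max_exists:
  fixes v :: "'a::euclidean_space \<Rightarrow> real"
  assumes cont: "continuous_on UNIV v" and bdd: "\<And>x. \<bar>v x\<bar> \<le> V" and "s > 0" "\<epsilon> > 0"
  obtains x y where "\<And>x' y'. v y' - v x' - s * norm (y' - x') - \<epsilon> * (norm x')\<^sup>2
                \<le> v y - v x - s * norm (y - x) - \<epsilon> * (norm x)\<^sup>2"
proof -
  define F where "F = (\<lambda>(x, y). v y - v x - s * norm (y - x) - \<epsilon> * (norm x)\<^sup>2)"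
  \<comment> \<open>Differences of values of \<open>v\<close> are at most \<open>2 * V\<close>.
    Where the functional is nonnegative, the quadratic penalty therefore keeps \<open>x\<close>
    within \<open>R\<close>, and the distance penalty keeps \<open>y\<close> within
    \<open>2 * V / s\<close> of \<open>x\<close>.\<close>
  define R where "R = sqrt (2 * V / \<epsilon>)"
  define K where "K = cball (0::'a) R \<times> cball (0::'a) (R + 2 * V / s)"
  have V: "V \<ge> 0" using bdd[of 0] by linarith
  have "compact K" unfolding K_def by (intro compact_Times compact_cball)
  have 0: "(0, 0) \<in> K" using V \<open>s > 0\<close> \<open>\<epsilon> > 0\<close> by (auto simp: K_def R_def)
  have "continuous_on UNIV F"
    unfolding F_def split_def
    by (intro continuous_intros continuous_on_compose2[OF cont]) auto
  then obtain z where z: "z \<in> K" "\<And>w. w \<in> K \<Longrightarrow> F w \<le> F z"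
    using continuous_attains_sup[OF \<open>compact K\<close>, of F] 0 continuous_on_subset by blast
  have F0: "F (0, 0) = 0" by (simp add: F_def)
  have in_K: "(x, y) \<in> K" if "F (x, y) \<ge> 0" for x y
  proof -
    have le: "s * norm (y - x) + \<epsilon> * (norm x)\<^sup>2 \<le> 2 * V"
      using that bdd[of x] bdd[of y] by (simp add: F_def)
    have nn: "s * norm (y - x) \<ge> 0" "\<epsilon> * (norm x)\<^sup>2 \<ge> 0" using \<open>s > 0\<close> \<open>\<epsilon> > 0\<close> by auto
    have "(norm x)\<^sup>2 \<le> 2 * V / \<epsilon>"
      using le nn \<open>\<epsilon> > 0\<close> by (simp add: pos_le_divide_eq mult.commute)
    then have x: "norm x \<le> R" unfolding R_def by (rule real_le_rsqrt)
    have "norm (y - x) \<le> 2 * V / s"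
      using le nn \<open>s > 0\<close> by (simp add: pos_le_divide_eq mult.commute)
    then show ?thesis using x norm_triangle_sub[of y x] by (simp add: K_def)
  qed
  have "F w \<le> F z" for w
  proof (cases "F w \<ge> 0")
    case True
    then show ?thesis using in_K[of "fst w" "snd w"] z(2) by simp
  next
    case False
    then show ?thesis using z(2)[OF 0] F0 by simp
  qed
  then have "F (x', y') \<le> F (fst z, snd z)" for x' y' by simp
  then show thesis by (intro that[where x="fst z" and y="snd z"]) (simp add: F_def split_def)
qed

text \<open>If the bound failed, the penalised maxima would keep a fixed gap in
  \<open>\<psi>\<close> while the errors vanish with \<open>\<epsilon>\<close>, and the limit would
  contradict \<open>dec\<close>. The limit is taken among values of \<open>u\<close>, since the
  points may escape to infinity; the interval includes \<open>0\<close> because the infimum of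
  \<open>u\<close> may be \<open>0\<close>.\<close>

lemma two_point_estimate:
  fixes u :: "real ^ 'n::finite \<Rightarrow> real" and C :: "real \<times> real \<Rightarrow> real"
  assumes cu: "continuous_on UNIV u" and ran: "\<And>x. u x \<in> {0..L}"
    and c\<psi>: "continuous_on {0..L} \<psi>" and mono: "mono_on {0..L} \<psi>"
    and v: "has_partial_derivs (\<lambda>x. \<psi> (u x))"
    and v2: "\<And>i. has_partial_derivs (partial_deriv i (\<lambda>x. \<psi> (u x)))"
    and eq: "\<And>x. laplacian (\<lambda>x. \<psi> (u x)) x = - C (norm (grad (\<lambda>x. \<psi> (u x)) x), u x)"
    and cC: "continuous_on ({0..} \<times> {0..L}) C"
    and "s > 0" and dec: "\<And>a b. 0 \<le> a \<Longrightarrow> a < b \<Longrightarrow> b \<le> L \<Longrightarrow> C (s, b) < C (s, a)"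
  shows "\<psi> (u y) - \<psi> (u x) \<le> s * norm (y - x)"
proof (rule ccontr)
  assume neg: "\<not> \<psi> (u y) - \<psi> (u x) \<le> s * norm (y - x)"
  define v where "v = (\<lambda>x. \<psi> (u x))"
  define m where "m = (v y - v x - s * norm (y - x)) / 2"
  have "m > 0" using neg by (simp add: m_def v_def)
  have cv: "continuous_on UNIV v"
    unfolding v_def by (rule continuous_on_compose2[OF c\<psi> cu]) (use ran in auto)
  obtain V where V: "\<And>a. a \<in> {0..L} \<Longrightarrow> \<bar>\<psi> a\<bar> \<le> V"
    using compact_imp_bounded[OF compact_continuous_image[OF c\<psi> compact_Icc]]
    unfolding bounded_iff by (metis imageI real_norm_def)
  have bdd: "\<bar>v x\<bar> \<le> V" for x using V ran by (simp add: v_def)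
  \<comment> \<open>For \<open>\<epsilon> \<le> E\<close> the penalty at the given \<open>x\<close>
    costs at most \<open>m\<close>, half of the excess; the other half bounds every penalised
    maximum from below.\<close>
  define E where "E = m / (1 + (norm x)\<^sup>2)"
  have pos: "1 + (norm x)\<^sup>2 > 0" by (simp add: add_pos_nonneg)
  have "E > 0" using \<open>m > 0\<close> pos by (simp add: E_def)
  \<comment> \<open>Here \<open>a\<close> and \<open>b\<close> are the values of \<open>u\<close> at
    the two maximum points, and \<open>r\<close> is the length of the gradient of \<open>v\<close>
    at the penalised one.\<close>
  have "\<exists>a b r. a \<in> {0..L} \<and> b \<in> {0..L} \<and> m \<le> \<psi> b - \<psi> a \<and> 0 \<le> r \<and>
      \<bar>r - s\<bar> \<le> 2 * sqrt (2 * V * \<epsilon>) \<and> C (r, a) - C (s, b) \<le> 2 * \<epsilon> * real CARD('n)"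
    if \<epsilon>: "\<epsilon> > 0" "\<epsilon> \<le> E" for \<epsilon>
  proof -
    obtain x' y' where max: "\<And>x'' y''. v y'' - v x'' - s * norm (y'' - x'') - \<epsilon> * (norm x'')\<^sup>2
                \<le> v y' - v x' - s * norm (y' - x') - \<epsilon> * (norm x')\<^sup>2"
      by (rule doubled_max_exists[OF cv bdd \<open>s > 0\<close> \<epsilon>(1)]) (rule that)
    have "\<epsilon> * (norm x)\<^sup>2 \<le> E * (1 + (norm x)\<^sup>2)"
      using \<epsilon> by (intro mult_mono) auto
    also have "\<dots> = m" using pos by (simp add: E_def)
    finally have "m \<le> v y - v x - s * norm (y - x) - \<epsilon> * (norm x)\<^sup>2"
      by (simp add: m_def field_simps)
    with max[of y x] have ge: "m \<le> v y' - v x' - s * norm (y' - x') - \<epsilon> * (norm x')\<^sup>2"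
      by linarith
    have nn: "s * norm (y' - x') \<ge> 0" "\<epsilon> * (norm x')\<^sup>2 \<ge> 0" using \<open>s > 0\<close> \<epsilon> by auto
    have "x' \<noteq> y'" using ge nn \<open>m > 0\<close> by auto
    note c = doubled_max_conditions[of v x' y' s \<epsilon>, OF v[folded v_def] v2[folded v_def] this max]
    let ?w = "(s / norm (y' - x')) *\<^sub>R (y' - x')"
    have w: "norm ?w = s" using \<open>x' \<noteq> y'\<close> \<open>s > 0\<close> by simp
    \<comment> \<open>A bound on \<open>\<epsilon>\<close> times the squared norm makes
      \<open>\<epsilon> * norm x'\<close> of order \<open>sqrt \<epsilon>\<close>, so the
      perturbation of the gradient vanishes even if \<open>x'\<close> is unbounded.\<close>
    have "\<epsilon> * (norm x')\<^sup>2 \<le> 2 * V" using ge nn \<open>m > 0\<close> bdd[of x'] bdd[of y'] by linarith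
    then have "\<epsilon> * (\<epsilon> * (norm x')\<^sup>2) \<le> \<epsilon> * (2 * V)" using \<epsilon> by (intro mult_left_mono) auto
    then have "(\<epsilon> * norm x')\<^sup>2 \<le> 2 * V * \<epsilon>"
      by (simp add: power2_eq_square algebra_simps)
    then have small: "\<epsilon> * norm x' \<le> sqrt (2 * V * \<epsilon>)" by (rule real_le_rsqrt)
    have "\<bar>norm (grad v x') - s\<bar> \<le> norm (grad v x' - ?w)"
      using norm_triangle_ineq3[of "grad v x'" ?w] w by simp
    also have "\<dots> = 2 * (\<epsilon> * norm x')" using c(2) \<epsilon> by simp
    finally have "\<bar>norm (grad v x') - s\<bar> \<le> 2 * sqrt (2 * V * \<epsilon>)" using small by linarith
    moreover have "C (norm (grad v x'), u x') - C (s, u y') \<le> 2 * \<epsilon> * real CARD('n)"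
      using c(3) eq[of x', folded v_def] eq[of y', folded v_def] c(1) w by simp
    moreover have "m \<le> \<psi> (u y') - \<psi> (u x')" using ge nn by (simp add: v_def)
    ultimately show ?thesis using ran by (meson norm_ge_zero)
  qed
  \<comment> \<open>The choice \<open>\<epsilon> = E / Suc k\<close> stays in the admissible range
    for all \<open>k\<close>, including \<open>0\<close>, and tends to \<open>0\<close>.\<close>
  then have "\<exists>a b r. a \<in> {0..L} \<and> b \<in> {0..L} \<and> m \<le> \<psi> b - \<psi> a \<and> 0 \<le> r \<and>
      \<bar>r - s\<bar> \<le> 2 * sqrt (2 * V * (E / Suc k)) \<and> C (r, a) - C (s, b) \<le> 2 * (E / Suc k) * real CARD('n)"
    for k
    by (rule meta_mp) (use \<open>E > 0\<close> in \<open>auto simp: field_simps\<close>)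
  then obtain a b r where k: "\<And>k. a k \<in> {0..L}" "\<And>k. b k \<in> {0..L}" "\<And>k. m \<le> \<psi> (b k) - \<psi> (a k)"
    "\<And>k. 0 \<le> r k" "\<And>k. \<bar>r k - s\<bar> \<le> 2 * sqrt (2 * V * (E / Suc k))"
    "\<And>k. C (r k, a k) - C (s, b k) \<le> 2 * (E / Suc k) * real CARD('n)"
    by metis
  have "\<exists>l\<in>{0..L} \<times> {0..L}. \<exists>\<sigma>. strict_mono \<sigma> \<and> ((\<lambda>k. (a k, b k)) \<circ> \<sigma>) \<longlonglongrightarrow> l"
    using compact_Times[OF compact_Icc compact_Icc, of 0 L 0 L] k(1,2)
    unfolding compact_def by (meson SigmaI)
  then obtain \<alpha> \<beta> \<sigma> where ab: "\<alpha> \<in> {0..L}" "\<beta> \<in> {0..L}" and \<sigma>: "strict_mono \<sigma>"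
    and lim: "(\<lambda>k. (a (\<sigma> k), b (\<sigma> k))) \<longlonglongrightarrow> (\<alpha>, \<beta>)"
    by (auto simp: o_def)
  have la: "(\<lambda>k. a (\<sigma> k)) \<longlonglongrightarrow> \<alpha>" and lb: "(\<lambda>k. b (\<sigma> k)) \<longlonglongrightarrow> \<beta>"
    using tendsto_fst[OF lim] tendsto_snd[OF lim] by auto
  have E0: "(\<lambda>k. E / Suc k) \<longlonglongrightarrow> 0"
    using tendsto_mult[OF tendsto_const[of E] LIMSEQ_inverse_real_of_nat] by (simp add: inverse_eq_divide)
  have "(\<lambda>k. 2 * sqrt (2 * V * (E / Suc k))) \<longlonglongrightarrow> 2 * sqrt (2 * V * 0)"
    by (intro tendsto_intros E0)
  then have z: "(\<lambda>k. 2 * sqrt (2 * V * (E / Suc k))) \<longlonglongrightarrow> 0"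
    by simp
  have "(\<lambda>k. r k - s) \<longlonglongrightarrow> 0"
    by (rule Lim_null_comparison[OF _ z]) (use k(5) in simp)
  then have "r \<longlonglongrightarrow> s" by (simp add: LIM_zero_iff)
  then have lr: "(\<lambda>k. r (\<sigma> k)) \<longlonglongrightarrow> s" using LIMSEQ_subseq_LIMSEQ[OF _ \<sigma>] by (auto simp: o_def)
  have "(\<lambda>k. C (r (\<sigma> k), a (\<sigma> k))) \<longlonglongrightarrow> C (s, \<alpha>)"
    by (rule continuous_on_tendsto_compose[OF cC tendsto_Pair[OF lr la]]) (use k ab \<open>s > 0\<close> in auto)
  moreover have "(\<lambda>k. C (s, b (\<sigma> k))) \<longlonglongrightarrow> C (s, \<beta>)"
    by (rule continuous_on_tendsto_compose[OF cC tendsto_Pair[OF tendsto_const lb]])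
      (use k ab \<open>s > 0\<close> in auto)
  ultimately have "(\<lambda>k. C (r (\<sigma> k), a (\<sigma> k)) - C (s, b (\<sigma> k))) \<longlonglongrightarrow> C (s, \<alpha>) - C (s, \<beta>)"
    by (rule tendsto_diff)
  moreover have "(\<lambda>k. 2 * (E / Suc (\<sigma> k)) * real CARD('n)) \<longlonglongrightarrow> 2 * 0 * real CARD('n)"
    using LIMSEQ_subseq_LIMSEQ[OF E0 \<sigma>] by (intro tendsto_intros) (simp add: o_def)
  ultimately have "C (s, \<alpha>) - C (s, \<beta>) \<le> 2 * 0 * real CARD('n)"
    by (rule LIMSEQ_le) (use k(6) in auto)
  \<comment> \<open>The gap \<open>m\<close> survives in the limit, and monotonicity of
    \<open>\<psi>\<close> then excludes \<open>\<beta> \<le> \<alpha>\<close>.\<close>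
  moreover have "\<alpha> < \<beta>"
  proof -
    have "(\<lambda>k. \<psi> (b (\<sigma> k)) - \<psi> (a (\<sigma> k))) \<longlonglongrightarrow> \<psi> \<beta> - \<psi> \<alpha>"
      by (intro tendsto_diff continuous_on_tendsto_compose[OF c\<psi> lb] continuous_on_tendsto_compose[OF c\<psi> la])
        (use k ab in auto)
    then have "m \<le> \<psi> \<beta> - \<psi> \<alpha>" by (rule LIMSEQ_le_const) (use k in auto)
    then have "\<not> \<psi> \<beta> \<le> \<psi> \<alpha>" using \<open>m > 0\<close> by simp
    then show ?thesis using mono_onD[OF mono, of \<beta> \<alpha>] ab by force
  qed
  ultimately show False using dec[of \<alpha> \<beta>] ab by auto
qed

section \<open>Choice of the profile and passage to constancy\<close>

text \<open>
  The last property says that the right-hand side of the equation for \<open>v\<close>, at gradient length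
  \<open>s\<close>, is strictly monotone in the value of \<open>u\<close>. For \<open>p = 2\<close> the profile \<open>g = exp (- e)\<close>, with
  \<open>e\<close> an antiderivative of the \<open>q\<close>-th power, would make \<open>v\<close> harmonic, and subtracting a constant
  gives strictness. For \<open>p > 2\<close> the nonlinear term is of lower order for small \<open>s\<close>, so it is
  absorbed by a \<open>g\<close> whose derivative is a negative multiple of the \<open>q\<close>-th power.
\<close>

lemma profile_exists:
  fixes p q L :: real
  assumes p: "p \<ge> 2" and q: "q > 0" and L: "L > 0"
  obtains g g' :: "real \<Rightarrow> real" and s\<^sub>0 :: real
  where "s\<^sub>0 > 0" "continuous_on {0..L} g" "continuous_on {0..L} g'"
    and "\<And>a. a \<in> {0..L} \<Longrightarrow> g a > 0"
    and "\<And>a. a > 0 \<Longrightarrow> (g has_real_derivative g' a) (at a)"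
    and "\<And>s a b. 0 < s \<Longrightarrow> s < s\<^sub>0 \<Longrightarrow> 0 \<le> a \<Longrightarrow> a < b \<Longrightarrow> b \<le> L \<Longrightarrow>
      g' b * s\<^sup>2 + b powr q * g b powr (p - 1) * s powr p
        < g' a * s\<^sup>2 + a powr q * g a powr (p - 1) * s powr p"
proof (cases "p = 2")
  case True
  define e where "e = (\<lambda>a. exp (- (a powr (q + 1) / (q + 1))))"
  \<comment> \<open>This \<open>A\<close> gives \<open>g L = e L > 0\<close>; as \<open>e\<close> is
    decreasing, \<open>g\<close> is positive on the whole interval.\<close>
  define A where "A = 1 + 1 / e L"
  define g where "g = (\<lambda>a. A * e a - 1)"
  define g' where "g' = (\<lambda>a. - (a powr q * (A * e a)))"
  have "e L > 0" by (simp add: e_def)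
  have "A > 0" unfolding A_def using \<open>e L > 0\<close> by (simp add: add_pos_pos)
  have gpos: "g a > 0" if "a \<in> {0..L}" for a
  proof -
    have "a powr (q + 1) \<le> L powr (q + 1)" using that q by (intro powr_mono2) auto
    then have "e L \<le> e a" using q by (simp add: e_def divide_right_mono)
    then have "A * e L \<le> A * e a" using \<open>A > 0\<close> by simp
    then show ?thesis using \<open>e L > 0\<close> by (simp add: g_def A_def algebra_simps)
  qed
  show thesis
  proof (rule that[of 1 g g'])
    show "continuous_on {0..L} g" "continuous_on {0..L} g'"
      unfolding g_def g'_def e_def using q by (auto intro!: continuous_intros continuous_on_powr')
    show "(g has_real_derivative g' a) (at a)" if "a > 0" for a
    proof -
      have "((\<lambda>a. a powr (q + 1) / (q + 1)) has_real_derivative a powr q) (at a)"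
        using that q by (auto intro!: derivative_eq_intros)
      then have "(e has_real_derivative e a * - (a powr q)) (at a)"
        unfolding e_def by (intro DERIV_fun_exp DERIV_minus)
      then show ?thesis
        unfolding g_def g'_def by (auto intro!: derivative_eq_intros)
    qed
    show "g' b * s\<^sup>2 + b powr q * g b powr (p - 1) * s powr p
        < g' a * s\<^sup>2 + a powr q * g a powr (p - 1) * s powr p"
      if "0 < s" "0 \<le> a" "a < b" "b \<le> L" for s a b
    proof -
      \<comment> \<open>Since \<open>A * e c = g c + 1\<close>, the nonlinear term cancels against
        \<open>g'\<close> and only the contribution of the subtracted constant is left.\<close>
      have C: "g' c * s\<^sup>2 + c powr q * g c powr (p - 1) * s powr p = - (s\<^sup>2 * c powr q)"
        if "c \<in> {0..L}" for c
      proof -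
        have h: "g' c = - (c powr q * (g c powr (p - 1) + 1))" "s powr p = s\<^sup>2"
          using gpos[OF that] True \<open>0 < s\<close> by (auto simp: g'_def g_def)
        show ?thesis unfolding h by (simp add: algebra_simps)
      qed
      have "a powr q < b powr q" using that q by (intro powr_less_mono2) auto
      then show ?thesis using that by (simp add: C)
    qed
  qed (use gpos in auto)
next
  case False
  then have p: "p > 2" using p by simp
  \<comment> \<open>The normalisation \<open>b * L powr (q + 1) = 1\<close> keeps \<open>g\<close>
    between \<open>1\<close> and \<open>2\<close> on the interval.\<close>
  define b where "b = L powr - (q + 1)"
  define g where "g = (\<lambda>a. 2 - b * a powr (q + 1))"
  define g' where "g' = (\<lambda>a. - (b * (q + 1) * a powr q))"
  \<comment> \<open>The threshold solves
    \<open>s powr (p - 2) * 2 powr (p - 1) = b * (q + 1)\<close>; below it the factor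
    \<open>B\<close> used later is positive, as \<open>g \<le> 2\<close>.\<close>
  define s\<^sub>0 where "s\<^sub>0 = (b * (q + 1) / 2 powr (p - 1)) powr (1 / (p - 2))"
  have "b > 0" using L by (simp add: b_def)
  have gb: "1 \<le> g a \<and> g a \<le> 2" if "a \<in> {0..L}" for a
  proof -
    have "a powr (q + 1) \<le> L powr (q + 1)" using that q by (intro powr_mono2) auto
    then have "b * a powr (q + 1) \<le> b * L powr (q + 1)" using \<open>b > 0\<close> by simp
    also have "\<dots> = 1" using L by (simp add: b_def flip: powr_add)
    finally show ?thesis using \<open>b > 0\<close> by (simp add: g_def)
  qed
  show thesis
  proof (rule that[of s\<^sub>0 g g'])
    show "s\<^sub>0 > 0" using \<open>b > 0\<close> q by (simp add: s\<^sub>0_def)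
    show "continuous_on {0..L} g" "continuous_on {0..L} g'"
      unfolding g_def g'_def using q by (auto intro!: continuous_intros continuous_on_powr')
    show "g a > 0" if "a \<in> {0..L}" for a using gb[OF that] by simp
    show "(g has_real_derivative g' a) (at a)" if "a > 0" for a
      unfolding g_def g'_def using that by (auto intro!: derivative_eq_intros)
    show "g' d * s\<^sup>2 + d powr q * g d powr (p - 1) * s powr p
        < g' a * s\<^sup>2 + a powr q * g a powr (p - 1) * s powr p"
      if s: "0 < s" "s < s\<^sub>0" and ad: "0 \<le> a" "a < d" "d \<le> L" for s a d
    proof -
      \<comment> \<open>After factoring out \<open>- (s\<^sup>2 * c powr q)\<close>, what remains is
        \<open>B\<close>, which is nondecreasing because \<open>g\<close> is nonincreasing.
        Strictness comes from the power of \<open>c\<close>.\<close>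
      define B where "B = (\<lambda>c. b * (q + 1) - s powr (p - 2) * g c powr (p - 1))"
      have sp: "s powr p = s\<^sup>2 * s powr (p - 2)"
        using s powr_add[of s 2 "p - 2"] by simp
      have C: "g' c * s\<^sup>2 + c powr q * g c powr (p - 1) * s powr p = - (s\<^sup>2 * (c powr q * B c))" for c
        by (simp add: g'_def B_def sp algebra_simps)
      have "s powr (p - 2) < s\<^sub>0 powr (p - 2)" using s p by (intro powr_less_mono2) auto
      also have "\<dots> = b * (q + 1) / 2 powr (p - 1)"
        using p \<open>b > 0\<close> q by (simp add: s\<^sub>0_def powr_powr)
      finally have s2: "s powr (p - 2) * 2 powr (p - 1) < b * (q + 1)"
        by (simp add: pos_less_divide_eq)
      have "g d powr (p - 1) \<le> 2 powr (p - 1)" using gb[of d] ad p by (intro powr_mono2) auto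
      then have "s powr (p - 2) * g d powr (p - 1) \<le> s powr (p - 2) * 2 powr (p - 1)"
        by (intro mult_left_mono) auto
      then have Bd: "B d > 0" using s2 by (simp add: B_def)
      have "a powr (q + 1) \<le> d powr (q + 1)" using ad q by (intro powr_mono2) auto
      then have "g d \<le> g a" using \<open>b > 0\<close> by (simp add: g_def)
      then have "g d powr (p - 1) \<le> g a powr (p - 1)" using gb[of d] ad p by (intro powr_mono2) auto
      then have "B a \<le> B d" by (simp add: B_def mult_left_mono)
      then have "a powr q * B a \<le> a powr q * B d" by (intro mult_left_mono) auto
      also have "\<dots> < d powr q * B d" using ad q Bd by (intro mult_strict_right_mono powr_less_mono2) auto
      finally show ?thesis using s by (simp add: C)
    qed
  qed
qed

theorem theorem1p1:
  fixes u :: "real ^ 'n::finite \<Rightarrow> real" and p q :: real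
  assumes "p \<ge> 2" and "q > 0"
    and "C2 u" and "bounded (range u)" and "\<And>x. u x > 0"
    and "\<And>x. - laplacian u x = u x powr q * norm (grad u x) powr p"
  shows "u constant_on UNIV"
proof -
  have cu: "continuous_on UNIV u" and u: "has_partial_derivs u"
    and u2: "\<And>i. has_partial_derivs (partial_deriv i u)"
    using \<open>C2 u\<close> by (auto simp: C2_def)
  obtain M where M: "\<And>x. \<bar>u x\<bar> \<le> M"
    using \<open>bounded (range u)\<close> by (auto simp: bounded_iff)
  \<comment> \<open>The added \<open>1\<close> puts the values of \<open>u\<close> strictly inside
    the interval, where \<open>\<psi>\<close> has two-sided derivatives.\<close>
  define L where "L = M + 1"
  have ran: "0 < u x" "u x < L" for x using M[of x] assms(5)[of x] by (auto simp: L_def)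
  then have "L > 0" by (meson less_trans)
  obtain g g' s\<^sub>0 where "s\<^sub>0 > 0" and cg: "continuous_on {0..L} g" "continuous_on {0..L} g'"
    and gpos: "\<And>a. a \<in> {0..L} \<Longrightarrow> g a > 0"
    and dg: "\<And>a. a > 0 \<Longrightarrow> (g has_real_derivative g' a) (at a)"
    and dec: "\<And>s a b. 0 < s \<Longrightarrow> s < s\<^sub>0 \<Longrightarrow> 0 \<le> a \<Longrightarrow> a < b \<Longrightarrow> b \<le> L \<Longrightarrow>
      g' b * s\<^sup>2 + b powr q * g b powr (p - 1) * s powr p
        < g' a * s\<^sup>2 + a powr q * g a powr (p - 1) * s powr p"
    by (rule profile_exists[OF assms(1,2) \<open>L > 0\<close>]) (rule that)
  have "continuous_on {0..L} (\<lambda>a. 1 / g a)"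
    using gpos by (intro continuous_intros cg) force
  then obtain \<psi> where "\<And>a. a \<in> {0..L} \<Longrightarrow> (\<psi> has_vector_derivative 1 / g a) (at a within {0..L})"
    by (rule antiderivative_continuous) (rule that)
  then have d\<psi>w: "(\<psi> has_real_derivative 1 / g a) (at a within {0..L})" if "a \<in> {0..L}" for a
    using that by (simp add: has_real_derivative_iff_has_vector_derivative)
  then have c\<psi>: "continuous_on {0..L} \<psi>" by (rule DERIV_continuous_on)
  have d\<psi>: "(\<psi> has_real_derivative 1 / g a) (at a)" if "0 < a" "a < L" for a
    using d\<psi>w[of a] that by (simp add: at_within_Icc_at)
  have d\<psi>': "((\<lambda>a. 1 / g a) has_real_derivative - g' a / (g a)\<^sup>2) (at a)" if "0 < a" "a < L" for a
    using dg[of a] gpos[of a] that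
    by (auto intro!: derivative_eq_intros simp: power2_eq_square)
  have less: "\<psi> a < \<psi> b" if "a \<in> {0..L}" "b \<in> {0..L}" "a < b" for a b
  proof (rule DERIV_pos_imp_increasing_open[OF \<open>a < b\<close>, of \<psi>])
    show "\<exists>y. (\<psi> has_real_derivative y) (at t) \<and> y > 0" if "a < t" "t < b" for t
      using d\<psi>[of t] gpos[of t] that \<open>a \<in> {0..L}\<close> \<open>b \<in> {0..L}\<close> by auto
    show "continuous_on {a..b} \<psi>" by (rule continuous_on_subset[OF c\<psi>]) (use that in auto)
  qed
  define C where "C = (\<lambda>(r, a). g' a * r\<^sup>2 + a powr q * g a powr (p - 1) * r powr p)"
  have cC: "continuous_on ({0..} \<times> {0..L}) C"
    unfolding C_def split_def using assms(1,2) gpos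
    by (intro continuous_intros continuous_on_powr' continuous_on_compose2[OF cg(1)]
        continuous_on_compose2[OF cg(2)]) (auto intro: less_imp_le)
  have eq: "laplacian (\<lambda>x. \<psi> (u x)) x = - C (norm (grad (\<lambda>x. \<psi> (u x)) x), u x)" for x
  proof -
    let ?N = "norm (grad u x)"
    have g: "g (u x) > 0" using gpos[of "u x"] ran[of x] by simp
    have n: "norm (grad (\<lambda>x. \<psi> (u x)) x) = ?N / g (u x)"
      using grad_compose[of u \<psi> "\<lambda>a. 1 / g a", OF u d\<psi>[OF ran]] g by simp
    \<comment> \<open>The exponent \<open>p - 1\<close> arises here: the gradient of
      \<open>u\<close> is \<open>g\<close> times that of \<open>v\<close>, which gives
      \<open>p\<close> factors of \<open>g\<close>, and \<open>\<psi>' = 1 / g\<close> removes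
      one.\<close>
    have "g (u x) powr (p - 1) * (?N / g (u x)) powr p = ?N powr p / g (u x)"
      using g by (simp add: powr_divide powr_diff)
    then have "C (?N / g (u x), u x) = g' (u x) * (?N / g (u x))\<^sup>2 + u x powr q * ?N powr p / g (u x)"
      by (simp add: C_def mult.assoc)
    also have "\<dots> = g' (u x) * (?N / g (u x))\<^sup>2 - laplacian u x / g (u x)"
      using assms(6)[of x, symmetric] by simp
    finally show ?thesis
      unfolding n laplacian_compose(2)[of u \<psi> "\<lambda>a. 1 / g a", OF u u2 d\<psi>[OF ran] d\<psi>'[OF ran]]
      by (simp add: power_divide)
  qed
  have est: "\<psi> (u y) - \<psi> (u x) \<le> s * norm (y - x)" if "0 < s" "s < s\<^sub>0" for s x y
  proof (rule two_point_estimate[OF cu _ c\<psi> _ _ _ eq cC \<open>0 < s\<close>])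
    show "u x \<in> {0..L}" for x using ran[of x] by simp
    show "mono_on {0..L} \<psi>"
      by (rule mono_onI) (metis less less_eq_real_def)
    show "has_partial_derivs (\<lambda>x. \<psi> (u x))"
      using partial_derivs_compose(1)[of u \<psi> "\<lambda>a. 1 / g a", OF u d\<psi>[OF ran]] .
    show "has_partial_derivs (partial_deriv i (\<lambda>x. \<psi> (u x)))" for i
      by (rule laplacian_compose(1)[of u \<psi> "\<lambda>a. 1 / g a", OF u u2 d\<psi>[OF ran] d\<psi>'[OF ran]])
    show "C (s, b) < C (s, a)" if "0 \<le> a" "a < b" "b \<le> L" for a b
      using dec[OF \<open>0 < s\<close> \<open>s < s\<^sub>0\<close> that] by (simp add: C_def)
  qed
  \<comment> \<open>For fixed points the Lipschitz bound holds for all small slopes, so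
    \<open>s\<close> may tend to \<open>0\<close>.\<close>
  have "\<psi> (u y) \<le> \<psi> (u x)" for x y
  proof (rule tendsto_lowerbound)
    show "((\<lambda>s. \<psi> (u x) + s * norm (y - x)) \<longlongrightarrow> \<psi> (u x)) (at_right 0)"
      by (auto intro!: tendsto_eq_intros)
    show "\<forall>\<^sub>F s in at_right 0. \<psi> (u y) \<le> \<psi> (u x) + s * norm (y - x)"
      unfolding eventually_at_right_field using est[of _ y x] \<open>s\<^sub>0 > 0\<close>
      by (intro exI[of _ "s\<^sub>0"]) (auto simp: algebra_simps)
  qed simp
  then have "u y \<le> u x" for x y
    using less[of "u x" "u y"] ran[of x] ran[of y] by (meson atLeastAtMost_iff leD less_imp_le linorder_not_le)
  then show ?thesis unfolding constant_on_def by (meson order_antisym UNIV_I)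
qed

end
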